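(* Let $N\ge 1$. Then for all $0\le i,j\le N$, $$S^{(N)}_{ij}=\sum_{\substack{0\le a,b\le 2^N-1\\ w(a)=i,\ w(b)=j}} H^{(N)}_{ab},$$ where $S^{(N)}$ is the symmetric Krawtchouk matrix of order $N$, $H^{(N)}$ is the $N$-th Sylvester-Hadamard matrix with rows and columns indexed from $0$ to $2^N-1$, and $w$ is the binary shuffling (binary weight) function.
   Context: The $N$-th order Krawtchouk matrix $K^{(N)}$ is the $(N+1)\times(N+1)$ matrix, with indices running from $0$ to $N$, determined by $(1+v)^{N-j}(1-v)^j=\sum_{i=0}^N v^i K^{(N)}_{ij}$. $B^{(N)}$ is the $(N+1)\times(N+1)$ diagonal matrix with $B^{(N)}_{ii}=\binom{N}{i}$, $0\le i\le N$. The symmetric Krawtchouk matrix is $S^{(N)}=K^{(N)}B^{(N)}$. Let $H=\begin{pmatrix}1&1\\1&-1\end{pmatrix}$. The Sylvester-Hadamard matrix $H^{(N)}=H^{\otimes N}$ is the $N$-fold Kronecker power of $H$, a $2^N\times 2^N$ matrix; its rows and columns are numbered in their usual order $0,1,\dots,2^N-1$. The binary shuffling function $w$ from nonnegative integers to nonnegative integers is the binary weight: if $n=\sum_k d_k2^k$ is the binary expansion of $n$, then $w(n)=\sum_k d_k$, the number of ones. *)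

theory Defs
  imports "Jordan_Normal_Form.Matrix" "HOL-Computational_Algebra.Polynomial"
begin

text \<open>Matrices have integer entries. Rows and columns are numbered from 0, as everywhere for the
  library type of matrices.\<close>

text \<open>Entry \<open>(i, j)\<close> is the coefficient of \<open>v ^ i\<close> in \<open>(1 + v) ^ (N - j) * (1 - v) ^ j\<close>.
  The truncated subtraction is harmless, since \<open>j \<le> N\<close> inside the matrix.\<close>

definition krawtchouk :: "nat \<Rightarrow> int mat" where
  "krawtchouk N = mat (N + 1) (N + 1)
     (\<lambda>(i, j). coeff ([:1, 1:] ^ (N - j) * [:1, -1:] ^ j) i)"

definition binomial_diag :: "nat \<Rightarrow> int mat" where
  "binomial_diag N = mat_diag (N + 1) (\<lambda>i. int (N choose i))"

definition symmetric_krawtchouk :: "nat \<Rightarrow> int mat" where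
  "symmetric_krawtchouk N = krawtchouk N * binomial_diag N"

lemma krawtchouk_generating_function:
  fixes v :: int
  assumes "j \<le> N"
  shows "(1 + v) ^ (N - j) * (1 - v) ^ j = (\<Sum>i = 0..N. v ^ i * krawtchouk N $$ (i, j))"
proof -
  let ?p = "[:1, 1:] ^ (N - j) * [:1, -1:] ^ j :: int poly"
  have "degree ?p \<le> degree ([:1, 1:] ^ (N - j) :: int poly) + degree ([:1, -1:] ^ j :: int poly)"
    by (rule degree_mult_le)
  also have "\<dots> \<le> (N - j) + j"
    using degree_power_le[of "[:1, 1:] :: int poly" "N - j"]
      degree_power_le[of "[:1, -1:] :: int poly" j] by (intro add_mono) auto
  finally have deg: "degree ?p \<le> N" using assms by simp
  have "(1 + v) ^ (N - j) * (1 - v) ^ j = poly ?p v"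
    by simp
  also have "\<dots> = (\<Sum>i\<le>N. coeff ?p i * v ^ i)"
    unfolding poly_altdef by (rule sum.mono_neutral_left) (use deg in \<open>auto simp: coeff_eq_0\<close>)
  also have "\<dots> = (\<Sum>i = 0..N. v ^ i * krawtchouk N $$ (i, j))"
    unfolding krawtchouk_def using assms
    by (intro sum.cong) (auto simp: mult.commute)
  finally show ?thesis .
qed

text \<open>Kronecker product: the block matrix whose block in position \<open>(p, q)\<close> is
  \<open>A $$ (p, q)\<close> times \<open>B\<close>.\<close>

definition kronecker :: "'a :: times mat \<Rightarrow> 'a mat \<Rightarrow> 'a mat" where
  "kronecker A B = mat (dim_row A * dim_row B) (dim_col A * dim_col B)
     (\<lambda>(i, j). A $$ (i div dim_row B, j div dim_col B) * B $$ (i mod dim_row B, j mod dim_col B))"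

fun kronecker_power :: "'a :: semiring_1 mat \<Rightarrow> nat \<Rightarrow> 'a mat" where
  "kronecker_power A 0 = 1\<^sub>m 1"
| "kronecker_power A (Suc n) = kronecker A (kronecker_power A n)"

definition sylvester_hadamard :: "nat \<Rightarrow> int mat" where
  "sylvester_hadamard N = kronecker_power (mat_of_rows_list 2 [[1, 1], [1, -1]]) N"

lemma sylvester_hadamard_carrier: "sylvester_hadamard N \<in> carrier_mat (2 ^ N) (2 ^ N)"
proof (induction N)
  case (Suc N)
  then show ?case
    by (auto simp: sylvester_hadamard_def kronecker_def mat_of_rows_list_def)
qed (simp add: sylvester_hadamard_def)

text \<open>The sum of the binary digits of \<open>n\<close>; digits at positions \<open>k \<ge> n\<close> vanish because
  \<open>n < 2 ^ n\<close>.\<close>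

definition binary_weight :: "nat \<Rightarrow> nat" where
  "binary_weight n = (\<Sum>k<n. n div 2 ^ k mod 2)"

lemma binary_weight_expansion:
  assumes "\<And>k. k < m \<Longrightarrow> d k \<in> {0, 1}" and "n = (\<Sum>k<m. d k * 2 ^ k)"
  shows "binary_weight n = (\<Sum>k<m. d k)"
proof -
  have digit: "(\<Sum>k<m. d k * 2 ^ k) div 2 ^ l mod 2 = (if l < m then d l else 0)"
    if "\<And>k. k < m \<Longrightarrow> d k \<in> {0, 1}" for l m and d :: "nat \<Rightarrow> nat"
    using that
  proof (induction m arbitrary: d l)
    case (Suc m)
    let ?r = "\<Sum>k<m. d (Suc k) * 2 ^ k"
    have split: "(\<Sum>k<Suc m. d k * 2 ^ k) = d 0 + 2 * ?r"
      by (subst sum.lessThan_Suc_shift) (simp add: sum_distrib_left mult_ac)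
    have d0: "d 0 = 0 \<or> d 0 = 1" using Suc.prems[of 0] by simp
    have IH: "?r div 2 ^ l mod 2 = (if l < m then d (Suc l) else 0)" for l
      using Suc.IH[of "\<lambda>k. d (Suc k)" l] Suc.prems by simp
    show ?case
    proof (cases l)
      case 0
      then show ?thesis using d0 unfolding split by auto
    next
      case (Suc l')
      have "(d 0 + 2 * ?r) div 2 ^ l = ?r div 2 ^ l'"
        using d0 by (auto simp: Suc div_mult2_eq)
      then show ?thesis unfolding split using IH[of l'] Suc by simp
    qed
  qed simp
  have dig: "n div 2 ^ k mod 2 = (if k < m then d k else 0)" for k
    using digit[of m d k] assms by simp
  have big: "n div 2 ^ k mod 2 = 0" if "n \<le> k" for k
  proof -
    have "n < 2 ^ k" using that less_exp[of k] by linarith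
    then show ?thesis by simp
  qed
  have "binary_weight n = (\<Sum>k<max m n. n div 2 ^ k mod 2)"
    unfolding binary_weight_def
    by (rule sum.mono_neutral_left) (use big in auto)
  also have "\<dots> = (\<Sum>k<m. n div 2 ^ k mod 2)"
    by (rule sum.mono_neutral_right) (auto simp: dig)
  also have "\<dots> = (\<Sum>k<m. d k)"
    by (simp add: dig)
  finally show ?thesis .
qed

end

theory Submission
  imports Defs
begin

text \<open>Fix a column \<open>b\<close> and weight the entry in row \<open>a\<close> by \<open>v ^ w(a)\<close>. Since the leading binary
  digits of \<open>a\<close> and \<open>b\<close> select the block of the Kronecker product, each digit of \<open>b\<close> contributes
  the factor \<open>1 + v\<close> if it is 0 and \<open>1 - v\<close> if it is 1. The column sum is therefore the
  generating function of column \<open>w(b)\<close> of the Krawtchouk matrix; it depends on \<open>b\<close> only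
  through \<open>w(b)\<close>, and \<open>N choose j\<close> columns have weight \<open>j\<close>.\<close>

text \<open>Digits at positions \<open>k\<close> with \<open>m \<le> k\<close> or
  \<open>n \<le> k\<close> vanish. A digit range common to all \<open>n\<close> below
  \<open>2 ^ m\<close> replaces the bound \<open>n\<close> of the definition and suits induction on
  \<open>m\<close>.\<close>

lemma binary_weight_eq_sum:
  assumes "n < 2 ^ m"
  shows "binary_weight n = (\<Sum>k<m. n div 2 ^ k mod 2)"
proof -
  have "n div 2 ^ k mod 2 = 0" if "m \<le> k \<or> n \<le> k" for k
  proof -
    have "n < 2 ^ k"
    proof (cases "m \<le> k")
      case True
      then have "(2::nat) ^ m \<le> 2 ^ k" by simp
      then show ?thesis using assms by linarith
    next
      case False
      then show ?thesis using that less_exp[of k] by linarith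
    qed
    then show ?thesis by simp
  qed
  then show ?thesis
    unfolding binary_weight_def by (intro sum.mono_neutral_cong) auto
qed

lemma binary_weight_le: "n < 2 ^ m \<Longrightarrow> binary_weight n \<le> m"
  using sum_bounded_above[of "{..<m}" "\<lambda>k. n div 2 ^ k mod 2" 1]
  by (simp add: binary_weight_eq_sum)

text \<open>Digit \<open>m\<close> of \<open>n\<close> is 0, so adding \<open>2 ^ m\<close> sets it
  without a carry.\<close>

lemma binary_weight_add_power:
  assumes "n < 2 ^ m"
  shows "binary_weight (2 ^ m + n) = Suc (binary_weight n)"
proof -
  have digit: "(2 ^ m + n) div 2 ^ k mod 2 = n div 2 ^ k mod 2" if "k < m" for k
  proof -
    obtain l where m: "m = k + Suc l" using \<open>k < m\<close> less_natE by (metis add_Suc_right)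
    \<comment> \<open>The added power contributes the even number \<open>2 * 2 ^ l\<close> to the
      quotient, so the parity is unchanged.\<close>
    have "(2 ^ m + n) div 2 ^ k = 2 * 2 ^ l + n div 2 ^ k"
      using div_mult_self4[of "2 ^ k" "2 * 2 ^ l" n] by (simp add: m power_add mult_ac)
    then show ?thesis by simp
  qed
  have "binary_weight (2 ^ m + n) = (\<Sum>k<Suc m. (2 ^ m + n) div 2 ^ k mod 2)"
    using assms by (intro binary_weight_eq_sum) simp
  also have "\<dots> = (\<Sum>k<m. n div 2 ^ k mod 2) + 1"
    using assms digit by simp
  finally show ?thesis using assms by (simp add: binary_weight_eq_sum)
qed

lemma sum_lessThan_add:
  fixes f :: "nat \<Rightarrow> 'a::comm_monoid_add"
  shows "(\<Sum>k<m + n. f k) = (\<Sum>k<m. f k) + (\<Sum>k<n. f (m + k))"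
  by (induction n) (simp_all add: add.assoc)

text \<open>Splits the range by the leading binary digit; this drives both inductions on
  \<open>N\<close> below.\<close>

lemma sum_lessThan_power2_Suc:
  fixes f :: "nat \<Rightarrow> 'a::comm_monoid_add"
  shows "(\<Sum>k<2 ^ Suc m. f k) = (\<Sum>k<2 ^ m. f k) + (\<Sum>k<2 ^ m. f (2 ^ m + k))"
  using sum_lessThan_add[of f "2 ^ m" "2 ^ m"] by (simp add: mult_2)

text \<open>Pascal's rule: the leading digit is either 0, leaving weight \<open>j\<close>, or 1,
  leaving weight \<open>j - 1\<close> for the remaining digits.\<close>

lemma card_binary_weight_eq: "card {b. b < 2 ^ N \<and> binary_weight b = j} = N choose j"
proof -
  \<comment> \<open>Counting by a sum of indicators lets the range be split.\<close>
  have "(\<Sum>b<2 ^ N. of_bool (binary_weight b = j)) = N choose j"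
  proof (induction N arbitrary: j)
    case 0
    then show ?case by (cases j) (simp_all add: binary_weight_def)
  next
    case (Suc N)
    have "(\<Sum>b<2 ^ Suc N. of_bool (binary_weight b = j)) =
        (N choose j) + (\<Sum>b<2 ^ N. of_bool (Suc (binary_weight b) = j))"
      unfolding sum_lessThan_power2_Suc Suc.IH by (simp add: binary_weight_add_power)
    then show ?case by (cases j) (simp_all add: Suc.IH)
  qed
  then show ?thesis by (simp add: Collect_conj_eq lessThan_def)
qed

text \<open>The leading digits of the row and column pick the entry of the 2 by 2 factor, which is
  -1 only when both are 1.\<close>

lemma sylvester_hadamard_Suc:
  assumes "a < 2 ^ N" and "b < 2 ^ N"
  shows "sylvester_hadamard (Suc N) $$ (a, b) = sylvester_hadamard N $$ (a, b)"
    and "sylvester_hadamard (Suc N) $$ (2 ^ N + a, b) = sylvester_hadamard N $$ (a, b)"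
    and "sylvester_hadamard (Suc N) $$ (a, 2 ^ N + b) = sylvester_hadamard N $$ (a, b)"
    and "sylvester_hadamard (Suc N) $$ (2 ^ N + a, 2 ^ N + b) = - sylvester_hadamard N $$ (a, b)"
proof -
  let ?H = "mat_of_rows_list 2 [[1, 1], [1, -1]] :: int mat"
  have Suc: "sylvester_hadamard (Suc N) = kronecker ?H (sylvester_hadamard N)"
    by (simp add: sylvester_hadamard_def)
  have dims: "dim_row (sylvester_hadamard N) = 2 ^ N" "dim_col (sylvester_hadamard N) = 2 ^ N"
    using sylvester_hadamard_carrier[of N] by auto
  have entries: "?H $$ (0, 0) = 1" "?H $$ (0, Suc 0) = 1" "?H $$ (Suc 0, 0) = 1"
    "?H $$ (Suc 0, Suc 0) = -1" "dim_row ?H = 2" "dim_col ?H = 2"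
    by (simp_all add: mat_of_rows_list_def)
  show "sylvester_hadamard (Suc N) $$ (a, b) = sylvester_hadamard N $$ (a, b)"
    "sylvester_hadamard (Suc N) $$ (2 ^ N + a, b) = sylvester_hadamard N $$ (a, b)"
    "sylvester_hadamard (Suc N) $$ (a, 2 ^ N + b) = sylvester_hadamard N $$ (a, b)"
    "sylvester_hadamard (Suc N) $$ (2 ^ N + a, 2 ^ N + b) = - sylvester_hadamard N $$ (a, b)"
    using assms unfolding Suc kronecker_def by (simp_all add: dims entries)
qed

text \<open>Stated for polynomials rather than for values at \<open>v\<close>, so that coefficients
  can be compared directly.\<close>

lemma sylvester_hadamard_column_polynomial:
  assumes "b < 2 ^ N"
  shows "(\<Sum>a<2 ^ N. monom (sylvester_hadamard N $$ (a, b)) (binary_weight a)) =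
    [:1, 1:] ^ (N - binary_weight b) * [:1, -1:] ^ binary_weight b"
  using assms
proof (induction N arbitrary: b)
  case 0
  then show ?case
    by (simp add: sylvester_hadamard_def binary_weight_def monom_0)
next
  case (Suc N)
  let ?f = "\<lambda>b. \<Sum>a<2 ^ N. monom (sylvester_hadamard N $$ (a, b)) (binary_weight a)"
  \<comment> \<open>Rows with leading digit 1 have weight one higher, hence an extra factor
    \<open>[:0, 1:]\<close>.\<close>
  have shift: "(\<Sum>a<2 ^ N. monom (sylvester_hadamard N $$ (a, b)) (Suc (binary_weight a))) =
      [:0, 1:] * ?f b" for b
    by (simp add: sum_distrib_left monom_Suc)
  show ?case
  proof (cases "b < 2 ^ N")
    case True
    have "(\<Sum>a<2 ^ Suc N. monom (sylvester_hadamard (Suc N) $$ (a, b)) (binary_weight a)) =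
        ?f b + [:0, 1:] * ?f b"
      unfolding sum_lessThan_power2_Suc
      using True by (simp add: sylvester_hadamard_Suc binary_weight_add_power shift)
    also have "\<dots> = [:1, 1:] * ?f b"
      by simp
    finally show ?thesis
      \<comment> \<open>The weight bound keeps the truncated subtraction exact:
        \<open>Suc N - binary_weight b\<close> is the successor of
        \<open>N - binary_weight b\<close>.\<close>
      unfolding Suc.IH[OF True] using binary_weight_le[OF True]
      by (simp only: Suc_diff_le power_Suc mult.assoc)
  next
    case False
    define c where "c = b - 2 ^ N"
    have b: "b = 2 ^ N + c" and c: "c < 2 ^ N"
      using False Suc.prems by (auto simp: c_def)
    \<comment> \<open>The column now meets the negated block in its lower half.\<close>
    have "(\<Sum>a<2 ^ Suc N. monom (sylvester_hadamard (Suc N) $$ (a, b)) (binary_weight a)) =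
        ?f c - [:0, 1:] * ?f c"
      unfolding sum_lessThan_power2_Suc b
      using c by (simp add: sylvester_hadamard_Suc binary_weight_add_power shift sum_negf
          flip: minus_monom)
    also have "\<dots> = [:1, -1:] * ?f c"
      by simp
    finally show ?thesis
      unfolding Suc.IH[OF c] b binary_weight_add_power[OF c]
      by (simp only: diff_Suc_Suc power_Suc mult.left_commute)
  qed
qed

text \<open>The coefficient at \<open>i\<close> of the column polynomial collects exactly the rows
  of weight \<open>i\<close>.\<close>

lemma sylvester_hadamard_column_sum:
  assumes "b < 2 ^ N" and "i \<le> N"
  shows "(\<Sum>a | a < 2 ^ N \<and> binary_weight a = i. sylvester_hadamard N $$ (a, b)) =
    krawtchouk N $$ (i, binary_weight b)"
proof -
  have "(\<Sum>a | a < 2 ^ N \<and> binary_weight a = i. sylvester_hadamard N $$ (a, b)) =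
      coeff (\<Sum>a<2 ^ N. monom (sylvester_hadamard N $$ (a, b)) (binary_weight a)) i"
    by (simp add: coeff_sum sum.If_cases Collect_conj_eq lessThan_def)
  then show ?thesis
    using assms binary_weight_le[OF assms(1)]
    by (simp add: sylvester_hadamard_column_polynomial krawtchouk_def)
qed

theorem theorem2p3:
  fixes N i j :: nat
  assumes "1 \<le> N" and "i \<le> N" and "j \<le> N"
  shows "symmetric_krawtchouk N $$ (i, j) =
    (\<Sum>(a, b) \<in> {(a, b). a \<le> 2 ^ N - 1 \<and> b \<le> 2 ^ N - 1 \<and>
        binary_weight a = i \<and> binary_weight b = j}.
      sylvester_hadamard N $$ (a, b))"
proof -
  let ?W = "\<lambda>k. {a. a < 2 ^ N \<and> binary_weight a = k}"
  have le_iff: "a \<le> 2 ^ N - 1 \<longleftrightarrow> a < 2 ^ N" for a :: nat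
    by (metis Suc_diff_1 less_Suc_eq_le pos2 zero_less_power)
  have "(\<Sum>(a, b) \<in> {(a, b). a \<le> 2 ^ N - 1 \<and> b \<le> 2 ^ N - 1 \<and>
        binary_weight a = i \<and> binary_weight b = j}. sylvester_hadamard N $$ (a, b)) =
      (\<Sum>(a, b) \<in> ?W i \<times> ?W j. sylvester_hadamard N $$ (a, b))"
    unfolding le_iff by (intro sum.cong) auto
  \<comment> \<open>Summing over rows first turns the inner sum into a column sum, the same for
    every \<open>b\<close> of weight \<open>j\<close>.\<close>
  also have "\<dots> = (\<Sum>b \<in> ?W j. \<Sum>a \<in> ?W i. sylvester_hadamard N $$ (a, b))"
    unfolding sum.cartesian_product[symmetric] by (rule sum.swap)
  also have "\<dots> = (\<Sum>b \<in> ?W j. krawtchouk N $$ (i, j))"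
    using assms by (intro sum.cong) (auto simp: sylvester_hadamard_column_sum)
  also have "\<dots> = krawtchouk N $$ (i, j) * int (N choose j)"
    by (simp add: card_binary_weight_eq)
  \<comment> \<open>Right multiplication by the diagonal matrix scales column \<open>j\<close> by
    \<open>N choose j\<close>.\<close>
  also have "\<dots> = symmetric_krawtchouk N $$ (i, j)"
    using assms mat_diag_mult_right[of "krawtchouk N" "N + 1" "N + 1" "\<lambda>i. int (N choose i)"]
    by (simp add: symmetric_krawtchouk_def binomial_diag_def krawtchouk_def)
  finally show ?thesis by simp
qed

end
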